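(* Let $X$ be a compact topological space with a Borel probability measure $\mu$ such that every nonempty open set has strictly positive measure, let $(\phi,g)$ be an admissible pair with $\phi:X\to V$, and let $\mathcal{F}$ be a vector space of continuous real-valued functions on $X$. The following statements hold. (1) The scaling constant is given by $$\alpha(\mathcal{F})=1-\inf_{\lambda\in B^{\vee}(\mathcal{F})}\inf_{x\in B}\lambda(x).$$ (2) Let $H$ be a subgroup of the group of continuous automorphisms (self-homeomorphisms) of $X$ which has enough symmetries (with respect to $\phi$, $\mu$ and $\mathcal{F}$). (a) For any point $u_0\in X$, $$\alpha(\mathcal{F})=1-\inf_{\lambda\in B^{\vee}(\mathcal{F})}\lambda(\phi(u_0)).$$ (b) If $H'\subseteq H$ is a compact subgroup which fixes $u_0$ and such that the restriction $\Psi_{|H'}$ is continuous, then $$\alpha(\mathcal{F})=1-\inf_{\lambda\in B^{\vee}(\mathcal{F})\cap W^{\vee}}\lambda(\phi(u_0)),$$ where $W^{\vee}\subseteq V^*$ is the subspace of linear forms $\ell$ such that $\ell\circ\Psi(h)=\ell$ for every $h\in H'$.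
   Context: $V$ is a real finite-dimensional vector space. A pair $(\phi,g)$, with $\phi:X\to V$ continuous and $g:V\to\mathbb{R}$ linear, is admissible if the affine hull of $\phi(X)$ equals $g^{-1}(1)$. Put $C=\mathrm{Cone}(\phi(X))$ (the convex cone generated by $\phi(X)$), $\overline{x}=\int_X\phi\,d\mu\in V$. Dual cone: $D^*=\{\ell:\ell(d)\ge0\ \forall d\in D\}$. For $\lambda\in V^*$ let $Q_\lambda(p,q)=\int_X\lambda(\phi(u))p(u)q(u)\,d\mu(u)$ for $p,q\in\mathcal{F}$. Define $C^*(\mathcal{F})=\{\lambda\in V^*:Q_\lambda\text{ is positive semidefinite on }\mathcal{F}\}$, $C(\mathcal{F})=C^*(\mathcal{F})^*\subseteq V$, $\Lambda=\{v\in V:g(v)=1\}$, $\Lambda^\vee=\{\ell\in V^*:\ell(\overline{x})=1\}$, $B=C\cap\Lambda$, $B(\mathcal{F})=C(\mathcal{F})\cap\Lambda$, $B^\vee=C^*\cap\Lambda^\vee$, $B^\vee(\mathcal{F})=C^*(\mathcal{F})\cap\Lambda^\vee$. The scaling constant $\alpha(\mathcal{F})$ is the infimum of the set of real numbers $\alpha>0$ for which $\frac1\alpha(B^\vee(\mathcal{F})-g)\subseteq B^\vee-g$ (equivalently, $B-\overline{x}\subseteq\alpha(B(\mathcal{F})-\overline{x})$), and $\alpha(\mathcal{F})=\infty$ if this set is empty. A subgroup $H$ of the continuous automorphisms of $X$ has enough symmetries if: (i) the elements of $H$ preserve $\mu$; (ii) $H$ acts transitively on $X$; (iii) there is a homomorphism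 $\Psi:H\to\mathrm{Hom}(V,V)$ with $\Psi(h)(\phi(u))=\phi(h(u))$ for all $u\in X$, $h\in H$; (iv) $f\circ h\in\mathcal{F}$ for all $f\in\mathcal{F}$, $h\in H$. In (b), $H'$ is a compact topological group and $\Psi$ is the homomorphism from (iii). *)

theory Defs
  imports "HOL-Probability.Probability" "HOL-Algebra.Group"
begin

text \<open>
  The space \<open>X\<close> is the whole type \<open>'x\<close>. A real finite-dimensional vector space \<open>V\<close> is a type of
  class \<open>euclidean_space\<close>; the inner product plays no role beyond providing the canonical topology.
  (The class excludes dimension 0, where no admissible pair exists as \<open>X\<close> is nonempty.)
  Since \<open>V\<close> is finite-dimensional, every linear map out of \<open>V\<close> is bounded, so \<open>V\<^sup>*\<close> and
  \<open>Hom(V,V)\<close> are the types \<open>'v \<Rightarrow>\<^sub>L real\<close> and \<open>'v \<Rightarrow>\<^sub>L 'v\<close>.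
\<close>

definition full_borel_prob :: "'x::topological_space measure \<Rightarrow> bool" where
  "full_borel_prob \<mu> \<longleftrightarrow> prob_space \<mu> \<and> sets \<mu> = sets borel \<and>
     (\<forall>U. open U \<and> U \<noteq> {} \<longrightarrow> emeasure \<mu> U > 0)"

definition admissible :: "('x::topological_space \<Rightarrow> 'v::euclidean_space) \<Rightarrow> ('v \<Rightarrow>\<^sub>L real) \<Rightarrow> bool" where
  "admissible \<phi> g \<longleftrightarrow> continuous_on UNIV \<phi> \<and> affine hull (range \<phi>) = {v. g v = 1}"

definition continuous_function_space :: "('x::topological_space \<Rightarrow> real) set \<Rightarrow> bool" where
  "continuous_function_space F \<longleftrightarrow>
     (\<forall>f\<in>F. continuous_on UNIV f) \<and>
     (\<lambda>_. 0) \<in> F \<and>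
     (\<forall>p\<in>F. \<forall>q\<in>F. (\<lambda>u. p u + q u) \<in> F) \<and>
     (\<forall>c. \<forall>p\<in>F. (\<lambda>u. c * p u) \<in> F)"


subsection \<open>The cones, their sections and the scaling constant\<close>

definition dual_cone :: "'v::euclidean_space set \<Rightarrow> ('v \<Rightarrow>\<^sub>L real) set" where
  "dual_cone D = {l. \<forall>d\<in>D. 0 \<le> blinfun_apply l d}"

definition C_cone :: "('x \<Rightarrow> 'v::euclidean_space) \<Rightarrow> 'v set" where
  "C_cone \<phi> = convex_cone hull (range \<phi>)"

definition barycenter :: "'x measure \<Rightarrow> ('x \<Rightarrow> 'v::euclidean_space) \<Rightarrow> 'v" where
  "barycenter \<mu> \<phi> = (\<integral>u. \<phi> u \<partial>\<mu>)"

definition Q_form :: "'x measure \<Rightarrow> ('x \<Rightarrow> 'v::euclidean_space) \<Rightarrow> ('v \<Rightarrow>\<^sub>L real) \<Rightarrow>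
    ('x \<Rightarrow> real) \<Rightarrow> ('x \<Rightarrow> real) \<Rightarrow> real" where
  "Q_form \<mu> \<phi> l p q = (\<integral>u. l (\<phi> u) * p u * q u \<partial>\<mu>)"

definition Cdual_F :: "'x measure \<Rightarrow> ('x \<Rightarrow> 'v::euclidean_space) \<Rightarrow> ('x \<Rightarrow> real) set \<Rightarrow>
    ('v \<Rightarrow>\<^sub>L real) set" where
  "Cdual_F \<mu> \<phi> F = {l. \<forall>p\<in>F. 0 \<le> Q_form \<mu> \<phi> l p p}"

definition Lambda :: "('v::euclidean_space \<Rightarrow>\<^sub>L real) \<Rightarrow> 'v set" where
  "Lambda g = {v. g v = 1}"

definition Lambda_dual :: "'x measure \<Rightarrow> ('x \<Rightarrow> 'v::euclidean_space) \<Rightarrow> ('v \<Rightarrow>\<^sub>L real) set" where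
  "Lambda_dual \<mu> \<phi> = {l. blinfun_apply l (barycenter \<mu> \<phi>) = 1}"

definition B_sec :: "('x \<Rightarrow> 'v::euclidean_space) \<Rightarrow> ('v \<Rightarrow>\<^sub>L real) \<Rightarrow> 'v set" where
  "B_sec \<phi> g = C_cone \<phi> \<inter> Lambda g"

definition Bdual :: "'x measure \<Rightarrow> ('x \<Rightarrow> 'v::euclidean_space) \<Rightarrow> ('v \<Rightarrow>\<^sub>L real) set" where
  "Bdual \<mu> \<phi> = dual_cone (C_cone \<phi>) \<inter> Lambda_dual \<mu> \<phi>"

definition Bdual_F :: "'x measure \<Rightarrow> ('x \<Rightarrow> 'v::euclidean_space) \<Rightarrow> ('x \<Rightarrow> real) set \<Rightarrow>
    ('v \<Rightarrow>\<^sub>L real) set" where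
  "Bdual_F \<mu> \<phi> F = Cdual_F \<mu> \<phi> F \<inter> Lambda_dual \<mu> \<phi>"

definition scaling_set :: "'x measure \<Rightarrow> ('x \<Rightarrow> 'v::euclidean_space) \<Rightarrow> ('v \<Rightarrow>\<^sub>L real) \<Rightarrow>
    ('x \<Rightarrow> real) set \<Rightarrow> real set" where
  "scaling_set \<mu> \<phi> g F =
     {\<alpha>. \<alpha> > 0 \<and> (\<lambda>l. (1 / \<alpha>) *\<^sub>R (l - g)) ` Bdual_F \<mu> \<phi> F \<subseteq> (\<lambda>l. l - g) ` Bdual \<mu> \<phi>}"

definition scaling_constant :: "'x measure \<Rightarrow> ('x \<Rightarrow> 'v::euclidean_space) \<Rightarrow> ('v \<Rightarrow>\<^sub>L real) \<Rightarrow>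
    ('x \<Rightarrow> real) set \<Rightarrow> ereal" where
  "scaling_constant \<mu> \<phi> g F =
     (if scaling_set \<mu> \<phi> g F = {} then \<infinity> else ereal (Inf (scaling_set \<mu> \<phi> g F)))"


subsection \<open>Symmetries\<close>

definition homeo_group :: "('x::topological_space \<Rightarrow> 'x) monoid" where
  "homeo_group = \<lparr>carrier = {h. \<exists>k. homeomorphism UNIV UNIV h k}, mult = (\<circ>), one = id\<rparr>"

lemma carrier_homeo_group: "h \<in> carrier homeo_group \<longleftrightarrow> (\<exists>k. homeomorphism UNIV UNIV h k)"
  by (simp add: homeo_group_def)

lemma group_homeo_group: "group homeo_group"
proof (rule groupI)
  fix h k :: "'a \<Rightarrow> 'a" assume "h \<in> carrier homeo_group" "k \<in> carrier homeo_group"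
  then obtain h' k' where "homeomorphism UNIV UNIV h h'" "homeomorphism UNIV UNIV k k'"
    unfolding carrier_homeo_group by blast
  then have "homeomorphism UNIV UNIV (h \<circ> k) (k' \<circ> h')"
    using homeomorphism_compose by blast
  then show "h \<otimes>\<^bsub>homeo_group\<^esub> k \<in> carrier homeo_group"
    unfolding carrier_homeo_group by (auto simp: homeo_group_def)
next
  have "homeomorphism UNIV UNIV (id :: 'a \<Rightarrow> 'a) id" by (simp add: homeomorphism_def)
  then show "\<one>\<^bsub>homeo_group\<^esub> \<in> carrier (homeo_group :: ('a \<Rightarrow> 'a) monoid)"
    unfolding carrier_homeo_group by (auto simp: homeo_group_def)
next
  fix h :: "'a \<Rightarrow> 'a" assume "h \<in> carrier homeo_group"
  then obtain k where k: "homeomorphism UNIV UNIV h k"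
    unfolding carrier_homeo_group by blast
  show "\<exists>y\<in>carrier homeo_group. y \<otimes>\<^bsub>homeo_group\<^esub> h = \<one>\<^bsub>homeo_group\<^esub>"
  proof (rule bexI)
    show "k \<in> carrier homeo_group"
      unfolding carrier_homeo_group using k homeomorphism_symD by blast
    show "k \<otimes>\<^bsub>homeo_group\<^esub> h = \<one>\<^bsub>homeo_group\<^esub>"
      using k by (simp add: homeo_group_def homeomorphism_def fun_eq_iff)
  qed
qed (simp_all add: homeo_group_def comp_assoc)

definition hom_monoid :: "('v::euclidean_space \<Rightarrow>\<^sub>L 'v) monoid" where
  "hom_monoid = \<lparr>carrier = UNIV, mult = (o\<^sub>L), one = id_blinfun\<rparr>"

definition symmetry_rep :: "('x::topological_space \<Rightarrow> 'v::euclidean_space) \<Rightarrow> ('x \<Rightarrow> 'x) set \<Rightarrow>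
    (('x \<Rightarrow> 'x) \<Rightarrow> ('v \<Rightarrow>\<^sub>L 'v)) \<Rightarrow> bool" where
  "symmetry_rep \<phi> H \<Psi> \<longleftrightarrow>
     \<Psi> \<in> hom (homeo_group\<lparr>carrier := H\<rparr>) hom_monoid \<and>
     (\<forall>h\<in>H. \<forall>u. \<Psi> h (\<phi> u) = \<phi> (h u))"

definition enough_symmetries :: "'x::topological_space measure \<Rightarrow> ('x \<Rightarrow> 'v::euclidean_space) \<Rightarrow>
    ('x \<Rightarrow> real) set \<Rightarrow> ('x \<Rightarrow> 'x) set \<Rightarrow> bool" where
  "enough_symmetries \<mu> \<phi> F H \<longleftrightarrow>
     (\<forall>h\<in>H. distr \<mu> \<mu> h = \<mu>) \<and>
     (\<forall>u v. \<exists>h\<in>H. h u = v) \<and>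
     (\<exists>\<Psi>. symmetry_rep \<phi> H \<Psi>) \<and>
     (\<forall>f\<in>F. \<forall>h\<in>H. f \<circ> h \<in> F)"

definition topological_group :: "('g, 'b) monoid_scheme \<Rightarrow> 'g topology \<Rightarrow> bool" where
  "topological_group G T \<longleftrightarrow> group G \<and> topspace T = carrier G \<and>
     continuous_map (prod_topology T T) T (\<lambda>(a, b). a \<otimes>\<^bsub>G\<^esub> b) \<and>
     continuous_map T T (\<lambda>a. inv\<^bsub>G\<^esub> a)"

definition W_dual :: "(('x \<Rightarrow> 'x) \<Rightarrow> ('v::euclidean_space \<Rightarrow>\<^sub>L 'v)) \<Rightarrow> ('x \<Rightarrow> 'x) set \<Rightarrow>
    ('v \<Rightarrow>\<^sub>L real) set" where
  "W_dual \<Psi> H' = {l. \<forall>h\<in>H'. l o\<^sub>L \<Psi> h = l}"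

end

theory Submission
  imports Defs
begin

text \<open>
  For \<open>l\<close> in \<open>B\<^sup>\<or>(F)\<close> and \<open>x\<close> in \<open>B\<close> one has \<open>g x = 1\<close>, so the functional
  \<open>(l - g) / \<alpha> + g\<close> takes the value \<open>(l x - 1) / \<alpha> + 1\<close> at \<open>x\<close>, which is nonnegative exactly when
  \<open>l x \<ge> 1 - \<alpha>\<close>. Let \<open>m\<close> be the infimum of \<open>l x\<close> over all such \<open>l\<close> and \<open>x\<close>. The admissible
  scalings are then the \<open>\<alpha> > 0\<close> with \<open>\<alpha> \<ge> 1 - m\<close>, and because \<open>g\<close> itself lies in \<open>B\<^sup>\<or>(F)\<close> we have
  \<open>m \<le> 1\<close>, so that their infimum is \<open>1 - m\<close>; if \<open>m = -\<infinity>\<close>, no scaling is admissible and both sides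
  are \<open>\<infinity>\<close>. The infimum over \<open>B\<close> is the infimum over the image of \<open>\<phi>\<close>: a bound \<open>l \<ge> c\<close> on \<open>B\<close> amounts to \<open>l - c g \<ge> 0\<close> on the cone \<open>C\<close>, and this
  can be tested on the generators of \<open>C\<close>.

  In the presence of symmetries, \<open>l \<mapsto> l \<circ> \<Psi> h\<close> maps \<open>B\<^sup>\<or>(F)\<close> to itself: substituting \<open>h u\<close> for
  \<open>u\<close> in the integral turns \<open>Q\<close> for \<open>l \<circ> \<Psi> h\<close> at \<open>p\<close> into \<open>Q\<close> for \<open>l\<close> at \<open>p \<circ> h\<^sup>-\<^sup>1\<close>. As \<open>H\<close> is
  transitive, any value \<open>l (\<phi> u)\<close> is therefore also a value at \<open>\<phi> u\<^sub>0\<close> of another functional in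
  \<open>B\<^sup>\<or>(F)\<close>.

  For the last formula, each \<open>l\<close> in \<open>B\<^sup>\<or>(F)\<close> has to be replaced by an \<open>H'\<close>-invariant one with the
  same value at \<open>\<phi> u\<^sub>0\<close>. Averaging over Haar measure would do this; a more elementary way is a
  fixed-point argument. The functionals in \<open>B\<^sup>\<or>(F)\<close> with the prescribed value at \<open>\<phi> u\<^sub>0\<close> form a
  nonempty closed convex set, which \<open>H'\<close> preserves because it fixes \<open>u\<^sub>0\<close>. By compactness \<open>H'\<close> acts
  through a bounded group of linear maps, and \<open>bounded_linear_group_fixed_point\<close> provides a fixed
  point.
\<close>

section \<open>Fixed points of bounded linear groups\<close>

text \<open>
  The function \<open>R x = sup {norm (A x) | A \<in> G}\<close> is a \<open>G\<close>-invariant norm equivalent to the Euclidean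
  one, so it attains its minimum on \<open>K\<close>. The parallelogram law makes the squared norm of \<open>A x\<close> strictly
  convex in \<open>x\<close>, uniformly in \<open>A\<close> because the inverses of the \<open>A\<close> are bounded too, so that \<open>R\<^sup>2\<close> is strictly
  convex as well. Hence the minimiser is unique, and \<open>G\<close>, which
  permutes the minimisers, fixes it.
\<close>

lemma bounded_linear_group_fixed_point:
  fixes G :: "('w::euclidean_space \<Rightarrow> 'w) set"
  assumes lin: "\<And>A. A \<in> G \<Longrightarrow> linear A"
    and ident: "(\<lambda>x. x) \<in> G"
    and comp: "\<And>A A'. A \<in> G \<Longrightarrow> A' \<in> G \<Longrightarrow> A \<circ> A' \<in> G"
    and left_inverse: "\<And>A. A \<in> G \<Longrightarrow> \<exists>A'\<in>G. \<forall>x. A' (A x) = x"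
    and bound: "\<And>A x. A \<in> G \<Longrightarrow> norm (A x) \<le> c * norm x"
    and K: "closed K" "convex K" "K \<noteq> {}"
    and stable: "\<And>A x. A \<in> G \<Longrightarrow> x \<in> K \<Longrightarrow> A x \<in> K"
  shows "\<exists>x\<in>K. \<forall>A\<in>G. A x = x"
proof -
  define R where "R x = (SUP A\<in>G. norm (A x))" for x
  have bdd: "bdd_above ((\<lambda>A. norm (A x)) ` G)" for x
    using bound by (intro bdd_aboveI2[where M = "c * norm x"]) auto
  have le_R: "norm (A x) \<le> R x" if "A \<in> G" for A x
    unfolding R_def using that bdd by (intro cSUP_upper) auto
  have R_le: "R x \<le> r" if "\<And>A. A \<in> G \<Longrightarrow> norm (A x) \<le> r" for x r
    unfolding R_def using that ident by (intro cSUP_least) auto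
  have norm_le_R: "norm x \<le> R x" for x
    using le_R[OF ident] by simp
  have lipschitz: "R x \<le> R y + c * norm (x - y)" for x y
  proof (rule R_le)
    fix A assume A: "A \<in> G"
    have "A x = A y + A (x - y)"
      using linear_diff[OF lin[OF A]] by simp
    then have "norm (A x) \<le> norm (A y) + norm (A (x - y))"
      by (metis norm_triangle_ineq)
    then show "norm (A x) \<le> R y + c * norm (x - y)"
      using le_R[OF A, of y] bound[OF A, of "x - y"] by linarith
  qed
  have "0 < c"
  proof (rule ccontr)
    assume "\<not> 0 < c"
    obtain b :: 'w where "b \<in> Basis" using nonempty_Basis by blast
    then show False using bound[OF ident, of b] \<open>\<not> 0 < c\<close> by simp
  qed
  have "c-lipschitz_on UNIV R"
  proof (rule lipschitz_onI)
    fix x y show "dist (R x) (R y) \<le> c * dist x y"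
      using lipschitz[of x y] lipschitz[of y x] by (simp add: dist_norm norm_minus_commute abs_le_iff)
  qed (use \<open>0 < c\<close> in simp)
  then have cont: "continuous_on S R" for S
    by (meson continuous_on_subset lipschitz_on_continuous_on top_greatest)
  obtain k where k: "k \<in> K" using K by blast
  \<comment> \<open>As \<open>R\<close> dominates the norm, it exceeds \<open>R k\<close> outside this ball.\<close>
  have "compact (K \<inter> cball 0 (R k))"
    using K by (simp add: closed_Int_compact)
  moreover have "k \<in> K \<inter> cball 0 (R k)"
    using k norm_le_R by simp
  ultimately obtain x where x: "x \<in> K" and x_min: "\<And>y. y \<in> K \<Longrightarrow> norm y \<le> R k \<Longrightarrow> R x \<le> R y"
    using continuous_attains_inf[OF _ _ cont, of "K \<inter> cball 0 (R k)"]
    by (metis (no_types, lifting) Int_iff empty_iff mem_cball_0)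
  have min: "R x \<le> R y" if "y \<in> K" for y
    using x_min[OF that] x_min[OF k] norm_le_R[of k] norm_le_R[of y] by linarith
  have "A x = x" if A: "A \<in> G" for A
  proof -
    define z where "z = (1/2) *\<^sub>R x + (1/2) *\<^sub>R A x"
    have "z \<in> K"
      unfolding z_def using K x stable[OF A x] by (intro convexD) auto
    then have "R x \<le> R z" by (rule min)
    have R_nonneg: "0 \<le> R y" for y
      using norm_le_R[of y] norm_ge_zero[of y] by linarith
    define d where "d = (norm (x - A x))\<^sup>2 / (4 * c\<^sup>2)"
    \<comment> \<open>The bound is uniform in \<open>A'\<close>, so it passes to the supremum: \<open>R\<^sup>2\<close> at the midpoint \<open>z\<close> of \<open>x\<close>
        and \<open>A x\<close> is at least \<open>d\<close> below its minimum, which forces \<open>d = 0\<close>.\<close>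
    have midpoint: "(norm (A' z))\<^sup>2 \<le> (R x)\<^sup>2 - d" if A': "A' \<in> G" for A'
    proof -
      have "(norm (A' z))\<^sup>2 = (norm (A' x))\<^sup>2 / 2 + (norm (A' (A x)))\<^sup>2 / 2
          - (norm (A' (x - A x)))\<^sup>2 / 4"
        unfolding z_def linear_diff[OF lin[OF A']] linear_add[OF lin[OF A']]
          linear_scale[OF lin[OF A']] power2_norm_eq_inner
        by (simp add: inner_simps inner_commute field_simps)
      moreover have "(norm (A' x))\<^sup>2 \<le> (R x)\<^sup>2" "(norm (A' (A x)))\<^sup>2 \<le> (R x)\<^sup>2"
        using le_R[OF A', of x] le_R[OF comp[OF A' A], of x] by (auto intro!: power_mono)
      moreover have "d \<le> (norm (A' (x - A x)))\<^sup>2 / 4"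
      proof -
        obtain A'' where "A'' \<in> G" "\<forall>y. A'' (A' y) = y" using left_inverse[OF A'] by blast
        then have "norm (x - A x) \<le> c * norm (A' (x - A x))"
          using bound[of A'' "A' (x - A x)"] by simp
        then have "(norm (x - A x))\<^sup>2 \<le> c\<^sup>2 * (norm (A' (x - A x)))\<^sup>2"
          by (metis norm_ge_zero power_mono power_mult_distrib)
        then show ?thesis
          using \<open>0 < c\<close> unfolding d_def by (simp add: field_simps)
      qed
      ultimately show ?thesis by linarith
    qed
    have "0 \<le> (R x)\<^sup>2 - d"
      using midpoint[OF ident] zero_le_power2 order_trans by blast
    moreover have "R z \<le> sqrt ((R x)\<^sup>2 - d)"
      using midpoint by (intro R_le real_le_rsqrt) auto
    ultimately have "(R z)\<^sup>2 \<le> (R x)\<^sup>2 - d"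
      using R_nonneg[of z] power_mono[of "R z" "sqrt ((R x)\<^sup>2 - d)" 2] by simp
    moreover have "(R x)\<^sup>2 \<le> (R z)\<^sup>2"
      using \<open>R x \<le> R z\<close> R_nonneg by (intro power_mono)
    ultimately have "d \<le> 0" by linarith
    then show ?thesis
      using \<open>0 < c\<close> unfolding d_def by (simp add: field_simps)
  qed
  with x show ?thesis by blast
qed


section \<open>Cones tested on their generators\<close>

lemma dual_cone_C_cone:
  fixes \<phi> :: "'x \<Rightarrow> 'v::euclidean_space"
  shows "dual_cone (C_cone \<phi>) = {l. \<forall>u. 0 \<le> blinfun_apply l (\<phi> u)}"
proof safe
  fix l u assume "l \<in> dual_cone (C_cone \<phi>)"
  moreover have "\<phi> u \<in> C_cone \<phi>"
    unfolding C_cone_def by (intro hull_inc) auto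
  ultimately show "0 \<le> blinfun_apply l (\<phi> u)"
    by (auto simp: dual_cone_def)
next
  fix l :: "'v \<Rightarrow>\<^sub>L real" assume l: "\<forall>u. 0 \<le> blinfun_apply l (\<phi> u)"
  have "convex_cone {v. 0 \<le> blinfun_apply l v}"
    by (simp add: convex_cone_iff blinfun.add_right blinfun.scaleR_right)
  then have "C_cone \<phi> \<subseteq> {v. 0 \<le> blinfun_apply l v}"
    unfolding C_cone_def using l by (intro hull_minimal) auto
  then show "l \<in> dual_cone (C_cone \<phi>)"
    by (auto simp: dual_cone_def)
qed

lemma admissible_apply:
  assumes "admissible \<phi> g"
  shows "blinfun_apply g (\<phi> u) = 1"
  using assms hull_inc[of "\<phi> u" "range \<phi>" affine] unfolding admissible_def by auto

lemma image_in_B_sec: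
  assumes "admissible \<phi> g"
  shows "\<phi> u \<in> B_sec \<phi> g"
  unfolding B_sec_def C_cone_def Lambda_def
  by (auto intro: hull_inc simp: admissible_apply[OF assms])

text \<open>
  The functional \<open>g\<close> is constantly 1 on \<open>B\<close> and on the image of \<open>\<phi>\<close>, so that subtracting \<open>c g\<close> reduces a bound by \<open>c\<close> to
  nonnegativity, for which testing on the generators of the cone is enough.
\<close>

lemma B_sec_bound_iff:
  fixes l :: "'v::euclidean_space \<Rightarrow>\<^sub>L real"
  assumes "admissible \<phi> g"
  shows "(\<forall>x\<in>B_sec \<phi> g. c \<le> blinfun_apply l x) \<longleftrightarrow> (\<forall>u. c \<le> blinfun_apply l (\<phi> u))"
proof
  show "\<forall>u. c \<le> blinfun_apply l (\<phi> u)" if "\<forall>x\<in>B_sec \<phi> g. c \<le> blinfun_apply l x"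
    using that image_in_B_sec[OF assms] by blast
next
  assume "\<forall>u. c \<le> blinfun_apply l (\<phi> u)"
  then have "l - c *\<^sub>R g \<in> dual_cone (C_cone \<phi>)"
    by (simp add: dual_cone_C_cone blinfun.diff_left blinfun.scaleR_left admissible_apply[OF assms])
  then show "\<forall>x\<in>B_sec \<phi> g. c \<le> blinfun_apply l x"
    by (auto simp: dual_cone_def B_sec_def Lambda_def blinfun.diff_left blinfun.scaleR_left)
qed

lemma INF_B_sec_eq_INF_image:
  fixes l :: "'v::euclidean_space \<Rightarrow>\<^sub>L real"
  assumes "admissible \<phi> g"
  shows "(INF x\<in>B_sec \<phi> g. ereal (blinfun_apply l x)) = (INF u. ereal (blinfun_apply l (\<phi> u)))"
proof (rule INF_eqI)
  fix x assume x: "x \<in> B_sec \<phi> g"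
  show "(INF u. ereal (blinfun_apply l (\<phi> u))) \<le> ereal (blinfun_apply l x)"
  proof (cases "INF u. ereal (blinfun_apply l (\<phi> u))")
    case (real r)
    then have "\<forall>u. r \<le> blinfun_apply l (\<phi> u)"
      by (metis INF_lower UNIV_I ereal_less_eq(3))
    then show ?thesis
      using B_sec_bound_iff[OF assms, of r l] x real by simp
  next
    case PInf
    then have "\<infinity> \<le> ereal (blinfun_apply l (\<phi> undefined))"
      by (metis INF_lower UNIV_I)
    then show ?thesis by simp
  qed simp
next
  fix y assume y: "\<And>x. x \<in> B_sec \<phi> g \<Longrightarrow> y \<le> ereal (blinfun_apply l x)"
  show "y \<le> (INF u. ereal (blinfun_apply l (\<phi> u)))"
    using y image_in_B_sec[OF assms] by (intro INF_greatest) blast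
qed


section \<open>Integrals over the space\<close>

lemma full_borel_prob_integrable:
  fixes f :: "'x::topological_space \<Rightarrow> 'b::euclidean_space"
  assumes "compact (UNIV :: 'x set)" "full_borel_prob \<mu>" "continuous_on UNIV f"
  shows "integrable \<mu> f"
proof -
  interpret prob_space \<mu> using assms by (simp add: full_borel_prob_def)
  have "bounded (range f)"
    using assms by (intro compact_imp_bounded compact_continuous_image)
  then obtain b where "\<And>u. norm (f u) \<le> b"
    unfolding bounded_iff by blast
  moreover have "f \<in> borel_measurable \<mu>"
    using borel_measurable_continuous_onI[OF assms(3)] measurable_cong_sets[of \<mu> borel borel borel] assms(2)
    by (auto simp: full_borel_prob_def)
  ultimately show ?thesis
    by (intro integrable_const_bound[where B = b]) auto
qed

text \<open>
  Being linear in \<open>l\<close>, the condition \<open>Q p p \<ge> 0\<close> says that \<open>l\<close> lies in a closed half-space whose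
  normal vector is an integral of \<open>\<phi>\<close>.
\<close>

lemma Q_form_eq_apply:
  fixes \<phi> :: "'x::topological_space \<Rightarrow> 'v::euclidean_space"
  assumes "compact (UNIV :: 'x set)" "full_borel_prob \<mu>" "continuous_on UNIV \<phi>"
    and "continuous_on UNIV p" "continuous_on UNIV q"
  shows "Q_form \<mu> \<phi> l p q = blinfun_apply l (\<integral>u. (p u * q u) *\<^sub>R \<phi> u \<partial>\<mu>)"
proof -
  have "integrable \<mu> (\<lambda>u. (p u * q u) *\<^sub>R \<phi> u)"
    using assms by (intro full_borel_prob_integrable continuous_intros)
  from integral_bounded_linear[OF blinfun.bounded_linear_right[of l] this]
  show ?thesis
    by (simp add: Q_form_def blinfun.scaleR_right mult_ac)
qed

lemma apply_barycenter:
  fixes \<phi> :: "'x::topological_space \<Rightarrow> 'v::euclidean_space"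
  assumes "compact (UNIV :: 'x set)" "full_borel_prob \<mu>" "continuous_on UNIV \<phi>"
  shows "blinfun_apply l (barycenter \<mu> \<phi>) = (\<integral>u. l (\<phi> u) \<partial>\<mu>)"
  unfolding barycenter_def
  by (rule integral_bounded_linear[OF blinfun.bounded_linear_right full_borel_prob_integrable, symmetric])
    fact+

lemma apply_g_barycenter:
  fixes \<phi> :: "'x::topological_space \<Rightarrow> 'v::euclidean_space"
  assumes "compact (UNIV :: 'x set)" "full_borel_prob \<mu>" "admissible \<phi> g"
  shows "blinfun_apply g (barycenter \<mu> \<phi>) = 1"
proof -
  interpret prob_space \<mu> using assms by (simp add: full_borel_prob_def)
  show ?thesis
    using assms by (simp add: apply_barycenter admissible_apply admissible_def prob_space)
qed

text \<open>
  As \<open>g\<close> is constantly 1 on the image of \<open>\<phi>\<close>, its form \<open>Q\<close> is the \<open>L\<^sup>2\<close> inner product.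
\<close>

lemma g_in_Bdual_F:
  fixes \<phi> :: "'x::topological_space \<Rightarrow> 'v::euclidean_space"
  assumes "compact (UNIV :: 'x set)" "full_borel_prob \<mu>" "admissible \<phi> g"
  shows "g \<in> Bdual_F \<mu> \<phi> F"
  by (simp add: Bdual_F_def Cdual_F_def Q_form_def Lambda_dual_def admissible_apply[OF assms(3)]
      apply_g_barycenter[OF assms])


section \<open>The scaling constant as an infimum over points of the space\<close>

lemma scaling_set_eq:
  fixes \<phi> :: "'x::topological_space \<Rightarrow> 'v::euclidean_space"
  assumes "compact (UNIV :: 'x set)" "full_borel_prob \<mu>" "admissible \<phi> g"
  shows "scaling_set \<mu> \<phi> g F =
    {\<alpha>. \<alpha> > 0 \<and> ereal (1 - \<alpha>) \<le> (INF l\<in>Bdual_F \<mu> \<phi> F. INF u. ereal (blinfun_apply l (\<phi> u)))}"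
proof -
  have "(1 / \<alpha>) *\<^sub>R (l - g) \<in> (\<lambda>l. l - g) ` Bdual \<mu> \<phi> \<longleftrightarrow> (\<forall>u. 1 - \<alpha> \<le> blinfun_apply l (\<phi> u))"
    if "\<alpha> > 0" and l: "l \<in> Bdual_F \<mu> \<phi> F" for \<alpha> l
  proof -
    have "(1 / \<alpha>) *\<^sub>R (l - g) \<in> (\<lambda>l. l - g) ` Bdual \<mu> \<phi> \<longleftrightarrow> (1 / \<alpha>) *\<^sub>R (l - g) + g \<in> Bdual \<mu> \<phi>"
      by (metis (no_types, lifting) add_diff_cancel diff_add_cancel image_iff)
    also have "\<dots> \<longleftrightarrow> (\<forall>u. 0 \<le> (blinfun_apply l (\<phi> u) - 1) / \<alpha> + 1)"
      using l apply_g_barycenter[OF assms]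
      by (simp add: Bdual_def Bdual_F_def Lambda_dual_def dual_cone_C_cone blinfun.add_left
          blinfun.diff_left blinfun.scaleR_left admissible_apply[OF assms(3)])
    also have "\<dots> \<longleftrightarrow> (\<forall>u. 1 - \<alpha> \<le> blinfun_apply l (\<phi> u))"
      using \<open>\<alpha> > 0\<close> by (simp add: field_simps)
    finally show ?thesis .
  qed
  then show ?thesis
    unfolding scaling_set_def image_subset_iff le_INF_iff ereal_less_eq by auto
qed

text \<open>
  The constraint \<open>\<alpha> > 0\<close> would cut off part of the half-line \<open>\<alpha> \<ge> 1 - m\<close> if \<open>m\<close> exceeded 1; for
  \<open>m = 1\<close> it removes the endpoint 0 but leaves the infimum unchanged.
\<close>

lemma Inf_threshold_set:
  fixes m :: ereal
  assumes "m \<le> 1" and S: "S = {\<alpha>. \<alpha> > 0 \<and> ereal (1 - \<alpha>) \<le> m}"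
  shows "(if S = {} then \<infinity> else ereal (Inf S)) = 1 - m"
proof (cases m)
  case (real r)
  then have "r \<le> 1" using assms(1) by simp
  have S': "S = (if r = 1 then {0<..} else {1 - r..})"
    using \<open>r \<le> 1\<close> by (auto simp: S real)
  then have "S \<noteq> {}" "Inf S = 1 - r"
    by auto
  then show ?thesis by (simp add: real one_ereal_def)
qed (use assms in auto)

lemma scaling_constant_eq:
  fixes \<phi> :: "'x::topological_space \<Rightarrow> 'v::euclidean_space"
  assumes "compact (UNIV :: 'x set)" "full_borel_prob \<mu>" "admissible \<phi> g"
  shows "scaling_constant \<mu> \<phi> g F =
    1 - (INF l\<in>Bdual_F \<mu> \<phi> F. INF u. ereal (blinfun_apply l (\<phi> u)))"
  unfolding scaling_constant_def
proof (rule Inf_threshold_set)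
  show "(INF l\<in>Bdual_F \<mu> \<phi> F. INF u. ereal (blinfun_apply l (\<phi> u))) \<le> 1"
    using g_in_Bdual_F[OF assms]
    by (rule INF_lower2) (simp add: admissible_apply[OF assms(3)])
qed (rule scaling_set_eq[OF assms])


section \<open>Symmetries\<close>

text \<open>
  Every vector differs by a multiple of a point of the image from a vector in the affine hyperplane
  \<open>g = 1\<close>, which is the affine hull of the image.
\<close>

lemma span_range_admissible:
  assumes "admissible \<phi> g"
  shows "span (range \<phi>) = UNIV"
proof -
  have sub: "v \<in> span (range \<phi>)" if "g v = 1" for v
    using that assms affine_hull_subset_span[of "range \<phi>"] by (auto simp: admissible_def)
  define w where "w = \<phi> undefined"
  have w: "w \<in> span (range \<phi>)" "g w = 1"
    unfolding w_def by (auto intro: span_base admissible_apply[OF assms])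
  have "v \<in> span (range \<phi>)" for v
  proof -
    have "v + (1 - g v) *\<^sub>R w \<in> span (range \<phi>)"
      by (rule sub) (simp add: blinfun.add_right blinfun.scaleR_right w)
    then have "v + (1 - g v) *\<^sub>R w - (1 - g v) *\<^sub>R w \<in> span (range \<phi>)"
      by (intro span_diff span_scale w)
    then show ?thesis by simp
  qed
  then show ?thesis by auto
qed

text \<open>
  This determines \<open>\<Psi> h\<close> by the rule \<open>\<Psi> h (\<phi> u) = \<phi> (h u)\<close>. In particular \<open>\<Psi>\<close> preserves the identity,
  which a multiplicative map into the monoid of all endomorphisms need not do.
\<close>

lemma blinfun_eq_on_range_admissible:
  fixes f f' :: "'v::euclidean_space \<Rightarrow>\<^sub>L 'v"
  assumes "admissible \<phi> g" "\<And>u. blinfun_apply f (\<phi> u) = blinfun_apply f' (\<phi> u)"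
  shows "f = f'"
proof (rule blinfun_eqI)
  fix v
  have "v \<in> span (range \<phi>)" using span_range_admissible[OF assms(1)] by simp
  then show "blinfun_apply f v = blinfun_apply f' v"
    using assms(2)
    by (intro linear_eq_on_span[of f f' "range \<phi>" v] bounded_linear.linear blinfun.bounded_linear_right) auto
qed

text \<open>
  Both conditions defining \<open>B\<^sup>\<or>(F)\<close> are integrals, and \<open>h\<close> preserves \<open>\<mu>\<close>; for the form \<open>Q\<close> the
  substitution moves \<open>p\<close> to \<open>p \<circ> h\<^sup>-\<^sup>1\<close>, which is again in \<open>F\<close>.
\<close>

lemma Bdual_F_symmetric:
  fixes \<phi> :: "'x::topological_space \<Rightarrow> 'v::euclidean_space"
  assumes "compact (UNIV :: 'x set)" "full_borel_prob \<mu>" "admissible \<phi> g"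
    and F: "continuous_function_space F"
    and H: "subgroup H homeo_group" "enough_symmetries \<mu> \<phi> F H" "symmetry_rep \<phi> H \<Psi>"
    and h: "h \<in> H" and l: "l \<in> Bdual_F \<mu> \<phi> F"
  shows "l o\<^sub>L \<Psi> h \<in> Bdual_F \<mu> \<phi> F"
proof -
  have cont: "continuous_on UNIV \<phi>" using assms by (simp add: admissible_def)
  have "h \<in> carrier homeo_group" by (rule subgroup.mem_carrier[OF H(1) h])
  then obtain k where k: "homeomorphism UNIV UNIV h k"
    unfolding carrier_homeo_group by blast
  have kH: "k \<in> H"
  proof -
    interpret group "homeo_group :: ('x \<Rightarrow> 'x) monoid" by (rule group_homeo_group)
    have "k \<in> carrier homeo_group"
      unfolding carrier_homeo_group using k homeomorphism_symD by blast
    moreover have "k \<otimes>\<^bsub>homeo_group\<^esub> h = \<one>\<^bsub>homeo_group\<^esub>"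
      using k by (simp add: homeo_group_def homeomorphism_def fun_eq_iff)
    ultimately have "inv\<^bsub>homeo_group\<^esub> h = k"
      using \<open>h \<in> carrier homeo_group\<close> by (intro inv_equality)
    then show ?thesis using subgroup.m_inv_closed[OF H(1) h] by simp
  qed
  have sets: "sets \<mu> = sets borel" using assms by (simp add: full_borel_prob_def)
  have meas: "f \<in> borel_measurable \<mu>" if "continuous_on UNIV f" for f :: "'x \<Rightarrow> real"
    using borel_measurable_continuous_onI[OF that] by (simp add: measurable_cong_sets[OF sets refl])
  have distr_h: "distr \<mu> \<mu> h = \<mu>"
    using H(2) h unfolding enough_symmetries_def by blast
  have "h \<in> measurable \<mu> \<mu>"
    using k borel_measurable_continuous_onI[of h]
    by (simp add: measurable_cong_sets[OF sets sets] homeomorphism_def)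
  then have change: "(\<integral>u. f (h u) \<partial>\<mu>) = (\<integral>u. f u \<partial>\<mu>)" if "continuous_on UNIV f" for f :: "'x \<Rightarrow> real"
    using integral_distr[of h \<mu> \<mu> f] meas[OF that] distr_h by simp
  have \<Psi>: "\<Psi> h (\<phi> u) = \<phi> (h u)" for u
    using H(3) h by (simp add: symmetry_rep_def)
  have "0 \<le> Q_form \<mu> \<phi> (l o\<^sub>L \<Psi> h) p p" if p: "p \<in> F" for p
  proof -
    have pk: "p \<circ> k \<in> F" using H(2) p kH unfolding enough_symmetries_def by blast
    define q where "q = p \<circ> k"
    have "continuous_on UNIV q"
      using F pk unfolding continuous_function_space_def q_def by blast
    then have "continuous_on UNIV (\<lambda>u. l (\<phi> u) * q u * q u)"
      using cont by (intro continuous_intros)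
    from change[OF this] have "Q_form \<mu> \<phi> (l o\<^sub>L \<Psi> h) p p = Q_form \<mu> \<phi> l q q"
      using k by (simp add: Q_form_def \<Psi> homeomorphism_def q_def)
    also have "\<dots> \<ge> 0" using l pk by (simp add: Bdual_F_def Cdual_F_def q_def)
    finally show ?thesis .
  qed
  moreover have "blinfun_apply (l o\<^sub>L \<Psi> h) (barycenter \<mu> \<phi>) = blinfun_apply l (barycenter \<mu> \<phi>)"
  proof -
    have "continuous_on UNIV (\<lambda>u. l (\<phi> u))"
      using cont by (intro continuous_intros)
    from change[OF this] show ?thesis
      unfolding apply_barycenter[OF assms(1,2) cont] by (simp add: \<Psi>)
  qed
  ultimately show ?thesis
    using l by (simp add: Bdual_F_def Cdual_F_def Lambda_dual_def)
qed

text \<open>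
  If \<open>h u\<^sub>0 = u\<close>, then \<open>l\<close> at \<open>\<phi> u\<close> has the value of \<open>l \<circ> \<Psi> h\<close> at \<open>\<phi> u\<^sub>0\<close>, so moving the point and
  moving the functional have the same effect.
\<close>

lemma INF_Bdual_F_transitive:
  fixes \<phi> :: "'x::topological_space \<Rightarrow> 'v::euclidean_space"
  assumes "compact (UNIV :: 'x set)" "full_borel_prob \<mu>" "admissible \<phi> g"
    "continuous_function_space F" "subgroup H homeo_group" "enough_symmetries \<mu> \<phi> F H"
  shows "(INF l\<in>Bdual_F \<mu> \<phi> F. INF u. ereal (blinfun_apply l (\<phi> u))) =
    (INF l\<in>Bdual_F \<mu> \<phi> F. ereal (blinfun_apply l (\<phi> u\<^sub>0)))"
proof (rule antisym)
  show "(INF l\<in>Bdual_F \<mu> \<phi> F. INF u. ereal (blinfun_apply l (\<phi> u)))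
      \<le> (INF l\<in>Bdual_F \<mu> \<phi> F. ereal (blinfun_apply l (\<phi> u\<^sub>0)))"
    by (intro INF_mono) (auto intro: INF_lower)
next
  obtain \<Psi> where \<Psi>: "symmetry_rep \<phi> H \<Psi>"
    using assms(6) by (auto simp: enough_symmetries_def)
  show "(INF l\<in>Bdual_F \<mu> \<phi> F. ereal (blinfun_apply l (\<phi> u\<^sub>0)))
      \<le> (INF l\<in>Bdual_F \<mu> \<phi> F. INF u. ereal (blinfun_apply l (\<phi> u)))"
  proof (intro INF_greatest)
    fix l u assume l: "l \<in> Bdual_F \<mu> \<phi> F"
    obtain h where h: "h \<in> H" "h u\<^sub>0 = u"
      using assms(6) unfolding enough_symmetries_def by blast
    have "blinfun_apply (l o\<^sub>L \<Psi> h) (\<phi> u\<^sub>0) = blinfun_apply l (\<phi> u)"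
      using \<Psi> h by (simp add: symmetry_rep_def)
    then show "(INF l\<in>Bdual_F \<mu> \<phi> F. ereal (blinfun_apply l (\<phi> u\<^sub>0))) \<le> ereal (blinfun_apply l (\<phi> u))"
      using INF_lower[OF Bdual_F_symmetric[OF assms \<Psi> h(1) l], of "\<lambda>l. ereal (blinfun_apply l (\<phi> u\<^sub>0))"]
      by simp
  qed
qed

section \<open>Invariant functionals\<close>

text \<open>
  The fixed-point theorem needs a Euclidean norm, so functionals are represented by vectors through
  the inner product; precomposition with \<open>\<Psi> h\<close> then becomes the adjoint of \<open>\<Psi> h\<close>.
\<close>

lemma Riesz_blinfun_inner_left:
  fixes l :: "'v::euclidean_space \<Rightarrow>\<^sub>L real"
  shows "\<exists>w. l = blinfun_inner_left w"
proof
  show "l = blinfun_inner_left (adjoint l 1)"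
    by (rule blinfun_eqI)
      (simp add: adjoint_works bounded_linear.linear blinfun.bounded_linear_right)
qed

lemma norm_adjoint_blinfun_le:
  fixes A :: "'v::euclidean_space \<Rightarrow>\<^sub>L 'v"
  shows "norm (adjoint A w) \<le> norm A * norm w"
proof (cases "adjoint A w = 0")
  case False
  have "norm (adjoint A w) * norm (adjoint A w) = A (adjoint A w) \<bullet> w"
    by (simp add: bounded_linear.linear blinfun.bounded_linear_right power2_norm_eq_inner
        flip: adjoint_works power2_eq_square)
  also have "\<dots> \<le> norm (A (adjoint A w)) * norm w"
    by (rule norm_cauchy_schwarz)
  also have "\<dots> \<le> (norm A * norm (adjoint A w)) * norm w"
    by (intro mult_right_mono norm_blinfun) auto
  finally show ?thesis using False by (simp add: mult_ac)
qed simp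

lemma closed_convex_Bdual_F_Riesz:
  fixes \<phi> :: "'x::topological_space \<Rightarrow> 'v::euclidean_space"
  assumes "compact (UNIV :: 'x set)" "full_borel_prob \<mu>" "admissible \<phi> g"
    "continuous_function_space F"
  shows "closed {w. blinfun_inner_left w \<in> Bdual_F \<mu> \<phi> F}"
    and "convex {w. blinfun_inner_left w \<in> Bdual_F \<mu> \<phi> F}"
proof -
  define m where "m p = (\<integral>u. (p u * p u) *\<^sub>R \<phi> u \<partial>\<mu>)" for p
  have "Q_form \<mu> \<phi> l p p = blinfun_apply l (m p)" if "p \<in> F" for l p
    unfolding m_def using assms that
    by (intro Q_form_eq_apply) (auto simp: admissible_def continuous_function_space_def)
  then have eq: "{w. blinfun_inner_left w \<in> Bdual_F \<mu> \<phi> F} =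
      (\<Inter>p\<in>F. {w. m p \<bullet> w \<ge> 0}) \<inter> {w. barycenter \<mu> \<phi> \<bullet> w = 1}"
    by (auto simp: Bdual_F_def Cdual_F_def Lambda_dual_def)
  show "closed {w. blinfun_inner_left w \<in> Bdual_F \<mu> \<phi> F}"
    unfolding eq by (intro closed_Int closed_INT ballI closed_halfspace_ge closed_hyperplane)
  show "convex {w. blinfun_inner_left w \<in> Bdual_F \<mu> \<phi> F}"
    unfolding eq by (intro convex_Int convex_INT convex_halfspace_ge convex_hyperplane)
qed

text \<open>
  The fixed-point theorem is applied to the vectors that represent functionals in \<open>B\<^sup>\<or>(F)\<close> with the
  same value as \<open>l\<close> at \<open>\<phi> u\<^sub>0\<close>; the group preserves this value since it fixes \<open>u\<^sub>0\<close>.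
\<close>

lemma invariant_element_Bdual_F:
  fixes \<phi> :: "'x::topological_space \<Rightarrow> 'v::euclidean_space"
  assumes base: "compact (UNIV :: 'x set)" "full_borel_prob \<mu>" "admissible \<phi> g"
    "continuous_function_space F"
    and H: "subgroup H homeo_group" "enough_symmetries \<mu> \<phi> F H" "symmetry_rep \<phi> H \<Psi>"
    and H': "subgroup H' homeo_group" "H' \<subseteq> H" "\<forall>h\<in>H'. h u\<^sub>0 = u\<^sub>0"
    and bounded: "bounded (\<Psi> ` H')"
    and l: "l \<in> Bdual_F \<mu> \<phi> F"
  shows "\<exists>l'\<in>Bdual_F \<mu> \<phi> F \<inter> W_dual \<Psi> H'. blinfun_apply l' (\<phi> u\<^sub>0) = blinfun_apply l (\<phi> u\<^sub>0)"
proof -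
  have \<Psi>: "\<Psi> h (\<phi> u) = \<phi> (h u)" if "h \<in> H'" for h u
    using H(3) H'(2) that by (auto simp: symmetry_rep_def)
  have \<Psi>_id: "\<Psi> id = id_blinfun" and id: "id \<in> H'"
  proof -
    show "id \<in> H'" using subgroup.one_closed[OF H'(1)] by (simp add: homeo_group_def)
    then show "\<Psi> id = id_blinfun"
      by (intro blinfun_eq_on_range_admissible[OF base(3)]) (simp add: \<Psi>)
  qed
  have comp: "h \<circ> h' \<in> H'" if "h \<in> H'" "h' \<in> H'" for h h'
    using subgroup.m_closed[OF H'(1) that] by (simp add: homeo_group_def)
  have \<Psi>_comp: "\<Psi> (h \<circ> h') = \<Psi> h o\<^sub>L \<Psi> h'" if "h \<in> H'" "h' \<in> H'" for h h'
    using that comp[OF that] by (intro blinfun_eq_on_range_admissible[OF base(3)]) (simp add: \<Psi>)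
  have inverse: "\<exists>k\<in>H'. h \<circ> k = id" if "h \<in> H'" for h
  proof -
    interpret group "homeo_group :: ('x \<Rightarrow> 'x) monoid" by (rule group_homeo_group)
    have "h \<otimes>\<^bsub>homeo_group\<^esub> inv\<^bsub>homeo_group\<^esub> h = \<one>\<^bsub>homeo_group\<^esub>"
      by (rule r_inv[OF subgroup.mem_carrier[OF H'(1) that]])
    then show ?thesis
      using subgroup.m_inv_closed[OF H'(1) that] by (auto simp: homeo_group_def)
  qed
  have lin: "linear (blinfun_apply (\<Psi> h))" for h
    by (intro bounded_linear.linear blinfun.bounded_linear_right)
  have adj: "blinfun_inner_left (adjoint (\<Psi> h) w) = blinfun_inner_left w o\<^sub>L \<Psi> h" for h w
    by (rule blinfun_eqI) (simp add: adjoint_works lin)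
  have adj_comp: "adjoint (\<Psi> h') (adjoint (\<Psi> h) w) = adjoint (\<Psi> (h \<circ> h')) w"
    if "h \<in> H'" "h' \<in> H'" for h h' w
  proof -
    have "adjoint (\<Psi> (h \<circ> h')) = adjoint (\<Psi> h') \<circ> adjoint (\<Psi> h)"
      by (rule adjoint_unique) (simp add: \<Psi>_comp[OF that] adjoint_works lin)
    then show ?thesis by simp
  qed
  have adj_id: "adjoint (\<Psi> id) = (\<lambda>w. w)"
    by (rule adjoint_unique) (simp add: \<Psi>_id)
  obtain c where c: "\<And>h. h \<in> H' \<Longrightarrow> norm (\<Psi> h) \<le> c"
    using bounded by (auto simp: bounded_iff)
  define K where "K = {w. blinfun_inner_left w \<in> Bdual_F \<mu> \<phi> F} \<inter> {w. \<phi> u\<^sub>0 \<bullet> w = l (\<phi> u\<^sub>0)}"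
  have "\<exists>w\<in>K. \<forall>A\<in>(\<lambda>h. adjoint (\<Psi> h)) ` H'. A w = w"
  proof (rule bounded_linear_group_fixed_point)
    show "linear A" if "A \<in> (\<lambda>h. adjoint (\<Psi> h)) ` H'" for A
      using that lin by (auto intro: adjoint_linear)
    show "(\<lambda>w. w) \<in> (\<lambda>h. adjoint (\<Psi> h)) ` H'"
      using adj_id id by (metis image_eqI)
    show "A \<circ> A' \<in> (\<lambda>h. adjoint (\<Psi> h)) ` H'"
      if "A \<in> (\<lambda>h. adjoint (\<Psi> h)) ` H'" "A' \<in> (\<lambda>h. adjoint (\<Psi> h)) ` H'" for A A'
      using that adj_comp comp by (auto simp: comp_def intro!: image_eqI)
    show "\<exists>A'\<in>(\<lambda>h. adjoint (\<Psi> h)) ` H'. \<forall>w. A' (A w) = w"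
      if "A \<in> (\<lambda>h. adjoint (\<Psi> h)) ` H'" for A
    proof -
      from that obtain h where h: "h \<in> H'" "A = adjoint (\<Psi> h)" by blast
      obtain k where "k \<in> H'" "h \<circ> k = id" using inverse[OF h(1)] by blast
      then have "\<forall>w. adjoint (\<Psi> k) (A w) = w"
        using adj_comp[OF h(1)] by (simp add: h(2) adj_id)
      then show ?thesis using \<open>k \<in> H'\<close> by blast
    qed
    show "norm (A w) \<le> c * norm w" if "A \<in> (\<lambda>h. adjoint (\<Psi> h)) ` H'" for A w
      using that c by (auto intro!: order_trans[OF norm_adjoint_blinfun_le] mult_right_mono)
    show "closed K" "convex K"
      unfolding K_def using closed_convex_Bdual_F_Riesz[OF base]
      by (auto intro: closed_Int closed_hyperplane convex_Int convex_hyperplane)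
    obtain w where "l = blinfun_inner_left w" using Riesz_blinfun_inner_left by blast
    then show "K \<noteq> {}" using l by (auto simp: K_def)
    show "A w \<in> K" if "A \<in> (\<lambda>h. adjoint (\<Psi> h)) ` H'" "w \<in> K" for A w
      using that Bdual_F_symmetric[OF base H] H'(2)
      by (auto simp: K_def adj adjoint_works lin \<Psi> H'(3))
  qed
  then obtain w where w: "w \<in> K" "\<And>h. h \<in> H' \<Longrightarrow> adjoint (\<Psi> h) w = w" by blast
  show ?thesis
  proof
    show "blinfun_inner_left w \<in> Bdual_F \<mu> \<phi> F \<inter> W_dual \<Psi> H'"
      using w by (auto simp: K_def W_dual_def simp flip: adj)
    show "blinfun_apply (blinfun_inner_left w) (\<phi> u\<^sub>0) = blinfun_apply l (\<phi> u\<^sub>0)"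
      using w(1) by (simp add: K_def)
  qed
qed

section \<open>Formulas for the scaling constant\<close>

theorem theorem1p4:
  fixes \<mu> :: "'x::topological_space measure"
    and \<phi> :: "'x \<Rightarrow> 'v::euclidean_space"
    and g :: "'v \<Rightarrow>\<^sub>L real"
    and F :: "('x \<Rightarrow> real) set"
  assumes "compact (UNIV :: 'x set)"
    and "full_borel_prob \<mu>"
    and "admissible \<phi> g"
    and "continuous_function_space F"
  shows
    "scaling_constant \<mu> \<phi> g F =
       1 - (INF l\<in>Bdual_F \<mu> \<phi> F. INF x\<in>B_sec \<phi> g. ereal (blinfun_apply l x))
     \<and>
     (\<forall>H. subgroup H homeo_group \<and> enough_symmetries \<mu> \<phi> F H \<longrightarrow>
       (\<forall>u\<^sub>0. scaling_constant \<mu> \<phi> g F =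
          1 - (INF l\<in>Bdual_F \<mu> \<phi> F. ereal (blinfun_apply l (\<phi> u\<^sub>0))))
       \<and>
       (\<forall>u\<^sub>0 \<Psi> H' T.
          symmetry_rep \<phi> H \<Psi> \<and>
          subgroup H' homeo_group \<and> H' \<subseteq> H \<and> (\<forall>h\<in>H'. h u\<^sub>0 = u\<^sub>0) \<and>
          topological_group (homeo_group\<lparr>carrier := H'\<rparr>) T \<and> compact_space T \<and>
          continuous_map T euclidean \<Psi> \<longrightarrow>
          scaling_constant \<mu> \<phi> g F =
            1 - (INF l\<in>Bdual_F \<mu> \<phi> F \<inter> W_dual \<Psi> H'. ereal (blinfun_apply l (\<phi> u\<^sub>0)))))"
proof (intro conjI allI impI; (elim conjE)?)
  show "scaling_constant \<mu> \<phi> g F =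
      1 - (INF l\<in>Bdual_F \<mu> \<phi> F. INF x\<in>B_sec \<phi> g. ereal (blinfun_apply l x))"
    unfolding INF_B_sec_eq_INF_image[OF assms(3)] by (rule scaling_constant_eq[OF assms(1-3)])
next
  fix H u\<^sub>0 assume H: "subgroup H homeo_group" "enough_symmetries \<mu> \<phi> F H"
  show "scaling_constant \<mu> \<phi> g F = 1 - (INF l\<in>Bdual_F \<mu> \<phi> F. ereal (blinfun_apply l (\<phi> u\<^sub>0)))"
    unfolding scaling_constant_eq[OF assms(1-3)] INF_Bdual_F_transitive[OF assms H, of u\<^sub>0] ..
next
  fix H u\<^sub>0 \<Psi> H' T
  assume H: "subgroup H homeo_group" "enough_symmetries \<mu> \<phi> F H" "symmetry_rep \<phi> H \<Psi>"
    and H': "subgroup H' homeo_group" "H' \<subseteq> H" "\<forall>h\<in>H'. h u\<^sub>0 = u\<^sub>0"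
    and T: "topological_group (homeo_group\<lparr>carrier := H'\<rparr>) T" "compact_space T"
      "continuous_map T euclidean \<Psi>"
  have "compactin euclidean (\<Psi> ` topspace T)"
    using T(2,3) by (intro image_compactin) (simp_all add: compact_space_def)
  then have bounded: "bounded (\<Psi> ` H')"
    using T(1) by (simp add: topological_group_def compact_imp_bounded)
  have "(INF l\<in>Bdual_F \<mu> \<phi> F. ereal (blinfun_apply l (\<phi> u\<^sub>0))) =
      (INF l\<in>Bdual_F \<mu> \<phi> F \<inter> W_dual \<Psi> H'. ereal (blinfun_apply l (\<phi> u\<^sub>0)))"
  proof (rule antisym)
    show "(INF l\<in>Bdual_F \<mu> \<phi> F \<inter> W_dual \<Psi> H'. ereal (blinfun_apply l (\<phi> u\<^sub>0)))
        \<le> (INF l\<in>Bdual_F \<mu> \<phi> F. ereal (blinfun_apply l (\<phi> u\<^sub>0)))"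
    proof (rule INF_mono)
      fix l assume "l \<in> Bdual_F \<mu> \<phi> F"
      from invariant_element_Bdual_F[OF assms H H' bounded this]
      show "\<exists>l'\<in>Bdual_F \<mu> \<phi> F \<inter> W_dual \<Psi> H'.
          ereal (blinfun_apply l' (\<phi> u\<^sub>0)) \<le> ereal (blinfun_apply l (\<phi> u\<^sub>0))"
        by (metis order_refl)
    qed
  qed (rule INF_superset_mono; simp)
  then show "scaling_constant \<mu> \<phi> g F =
      1 - (INF l\<in>Bdual_F \<mu> \<phi> F \<inter> W_dual \<Psi> H'. ereal (blinfun_apply l (\<phi> u\<^sub>0)))"
    unfolding scaling_constant_eq[OF assms(1-3)] INF_Bdual_F_transitive[OF assms H(1,2), of u\<^sub>0] by simp
qed

end
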